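(* Let $(X,d)$ be a complete metric space and let $Y$ be a locally convex space. Let $K\subset Y$ be a closed and convex cone in $Y$ and let $D\subset K$ be a nonempty, closed, semi-complete, convex and bounded subset of $K$ such that $0\notin \overline{D+K}$. Let $f:X\to Y$ be monotonically semicontinuous with respect to $K$ on $X$ and $K$-bounded. Then for every $x\in X$, $\varepsilon>0$ and $\lambda>0$ there exists $\bar{x}\in X$ such that (i) $\big(f(x)-K\big)\cap\big(f(\bar{x})+\varepsilon d(x,\bar{x})D\big)\neq\emptyset$, (ii) $\big(f(\bar{x})-K\big)\cap\big(f(z)+\varepsilon d(z,\bar{x})D\big)=\emptyset$ for every $z\in X$ with $z\neq\bar{x}$, (iii) moreover, if $x$ is an $\varepsilon\lambda$-approximate solution with respect to $D$ (for the problem of $K$-minimizing $f$ over $X$), then $d(x,\bar{x})<\lambda$.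
   Context: A locally convex space is a (real) linear topological space with a local base consisting of convex neighborhoods of the origin. $\overline{A}$ denotes the topological closure of $A$. For sets $A,B\subset Y$, $y\in Y$ and $t\in\mathbb{R}$: $A+B=\{a+b: a\in A, b\in B\}$, $y-A=\{y-a: a\in A\}$, $y+tA=\{y+ta: a\in A\}$. For $u,v\in Y$ write $u\le_K v$ if and only if $v-u\in K$. A subset $D\subset Y$ is semi-complete if every Cauchy sequence contained in $D$ has a limit in $D$. A function $f:X\to Y$ is monotonically semicontinuous with respect to $K$ at $x\in X$ if for every sequence $(x_i)\subset X$ with $x_i\to x$ satisfying $f(x_{i+1})\le_K f(x_i)$ for all $i\in\mathbb{N}$, we have $f(x)\le_K f(x_i)$ for all $i\in\mathbb{N}$. It is monotonically semicontinuous on $X$ if this holds at every $x\in X$. A function $f:X\to Y$ is $K$-bounded if there exists a bounded subset $M$ of $Y$ such that $f(X)\subset K+M$. Bounded subsets of $Y$ are meant in the sense of topological vector spaces (absorbed by every neighborhood of $0$). For $D\subset K$ with $0\notin D$ and $\eta>0$, a point $x\in X$ is an $\eta$-approximate solution with respect to $D$ (for the problem of $K$-minimizing $f$ over $X$) if $\big(f(x)-\eta D-K\big)\cap f(X)=\emptyset$, where $f(x)-\eta D-K=\{f(x)-\eta d'-k: d'\in D, k\in K\}$. *)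

theory Defs
  imports "HOL-Analysis.Analysis"
begin

text \<open>
  No separation axiom is imposed: a locally convex space need not be Hausdorff.
\<close>

class topological_real_vector = real_vector + topological_ab_group_add +
  assumes tendsto_scaleR_Pair:
    "LIM p (nhds c \<times>\<^sub>F nhds y). fst p *\<^sub>R snd p :> nhds (c *\<^sub>R y)"

text \<open>
  The library's \<^term>\<open>convex\<close> and \<^term>\<open>interior\<close> cannot occur in a class axiom (they are not
  local to a class), so the axiom spells them out; the lemma below gives the usual form.
\<close>

class locally_convex_space = topological_real_vector +
  assumes convex_local_base_raw:
    "open U \<Longrightarrow> 0 \<in> U \<Longrightarrow>
      \<exists>V. (\<forall>x\<in>V. \<forall>y\<in>V. \<forall>u\<ge>0. \<forall>v\<ge>0. u + v = 1 \<longrightarrow> u *\<^sub>R x + v *\<^sub>R y \<in> V)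
        \<and> (\<exists>W. open W \<and> 0 \<in> W \<and> W \<subseteq> V) \<and> V \<subseteq> U"

lemma convex_local_base:
  fixes U :: "'b::locally_convex_space set"
  assumes "open U" and "0 \<in> U"
  shows "\<exists>V. convex V \<and> 0 \<in> interior V \<and> V \<subseteq> U"
  using convex_local_base_raw[OF assms] unfolding convex_def interior_def by blast

text \<open>
  The library's \<^term>\<open>bounded\<close> and \<^term>\<open>Cauchy\<close> are the metric notions; the following are
  those of the linear topology.
\<close>

definition tvs_bounded :: "'b::locally_convex_space set \<Rightarrow> bool" where
  "tvs_bounded M \<longleftrightarrow>
     (\<forall>U. open U \<and> 0 \<in> U \<longrightarrow> (\<exists>r>0. \<forall>t\<ge>r. M \<subseteq> (\<lambda>u. t *\<^sub>R u) ` U))"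

definition tvs_Cauchy :: "(nat \<Rightarrow> 'b::locally_convex_space) \<Rightarrow> bool" where
  "tvs_Cauchy s \<longleftrightarrow>
     (\<forall>U. open U \<and> 0 \<in> U \<longrightarrow> (\<exists>N. \<forall>m\<ge>N. \<forall>n\<ge>N. s m - s n \<in> U))"

definition semi_complete :: "'b::locally_convex_space set \<Rightarrow> bool" where
  "semi_complete D \<longleftrightarrow>
     (\<forall>s. range s \<subseteq> D \<and> tvs_Cauchy s \<longrightarrow> (\<exists>l\<in>D. s \<longlonglongrightarrow> l))"

definition cone_le :: "'b::ab_group_add set \<Rightarrow> 'b \<Rightarrow> 'b \<Rightarrow> bool" where
  "cone_le K u v \<longleftrightarrow> v - u \<in> K"

definition mono_semicontinuous_at ::
    "'b::ab_group_add set \<Rightarrow> ('a::topological_space \<Rightarrow> 'b) \<Rightarrow> 'a \<Rightarrow> bool" where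
  "mono_semicontinuous_at K f x \<longleftrightarrow>
     (\<forall>s. s \<longlonglongrightarrow> x \<and> (\<forall>i. cone_le K (f (s (Suc i))) (f (s i)))
        \<longrightarrow> (\<forall>i. cone_le K (f x) (f (s i))))"

definition mono_semicontinuous ::
    "'b::ab_group_add set \<Rightarrow> ('a::topological_space \<Rightarrow> 'b) \<Rightarrow> bool" where
  "mono_semicontinuous K f \<longleftrightarrow> (\<forall>x. mono_semicontinuous_at K f x)"

definition cone_bounded :: "'b::locally_convex_space set \<Rightarrow> ('a \<Rightarrow> 'b) \<Rightarrow> bool" where
  "cone_bounded K f \<longleftrightarrow> (\<exists>M. tvs_bounded M \<and> range f \<subseteq> K + M)"

text \<open>
  Meaningful only for \<^term>\<open>D \<subseteq> K\<close>, \<^term>\<open>0 \<notin> D\<close> and \<^term>\<open>\<eta> > 0\<close>.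
\<close>

definition approx_solution ::
    "'b::real_vector set \<Rightarrow> 'b set \<Rightarrow> ('a \<Rightarrow> 'b) \<Rightarrow> real \<Rightarrow> 'a \<Rightarrow> bool" where
  "approx_solution K D f \<eta> x \<longleftrightarrow>
     {f x - \<eta> *\<^sub>R d - k |d k. d \<in> D \<and> k \<in> K} \<inter> range f = {}"

end

theory Submission
  imports Defs
begin

text \<open>
  Write \<open>z \<preceq> y\<close> for \<open>f y - f z \<in> \<epsilon> d(z, y) D + K\<close>. The sets \<open>t D + K\<close>
  (\<^term>\<open>decrements\<close> below) add up, because \<open>D\<close> is convex and \<open>K\<close> is a convex cone, and they shrink as
  \<open>t\<close> grows, because \<open>D \<subseteq> K\<close>; with the triangle inequality this makes \<open>\<preceq>\<close> a preorder. Conclusion (i)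
  says that \<open>xbar \<preceq> x\<close> and (ii) that only \<open>xbar\<close> itself is \<open>\<preceq> xbar\<close>, so the task is to find a minimal
  point below \<open>x\<close>. Conclusion (iii) is then immediate: \<open>d(x, xbar) \<ge> \<delta>\<close> would make \<open>f xbar\<close> one of the
  values excluded by approximate optimality of \<open>x\<close>.

  Ekeland's argument needs a real-valued potential that drops by at least \<open>\<epsilon> d(z, y)\<close> from \<open>y\<close> to \<open>z\<close>
  whenever \<open>z \<preceq> y\<close>. In place of a linear functional separating \<open>0\<close> from \<open>D + K\<close>, which would come from
  the Hahn-Banach theorem, the potential is the largest decrease still available,
  \<open>Q y = sup {t \<ge> 0. \<exists>z. f y - f z \<in> t D + K}\<close>. Additivity of the sets \<open>t D + K\<close> gives the drop, and
  \<open>Q y\<close> is finite by \<open>decrements_bounded\<close>: if \<open>t\<close> could be arbitrarily large, dividing by \<open>t\<close> would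
  produce points of \<open>D + K\<close> tending to \<open>0\<close>, as \<open>f\<close> is bounded below up to a bounded set.

  The other ingredient of Ekeland's argument is that the limit of a decreasing sequence lies below
  its members (\<open>limit_of_decreasing_sequence\<close>). Monotone semicontinuity gives this only for the order
  of \<open>K\<close>; the term in \<open>D\<close> cannot be passed to the limit by compactness, since \<open>D\<close> need not be compact.
  Instead the directions \<open>d\<^sub>i \<in> D\<close> of the successive steps are averaged with weights
  proportional to the step lengths. These averages form a Cauchy sequence, because \<open>D\<close> is bounded,
  and semi-completeness supplies a limit direction in \<open>D\<close> (\<open>infinite_convex_combination\<close>).
\<close>

section \<open>Scalar multiplication and bounded sets in a linear topology\<close>

lemma tendsto_scaleR_tvs:
  fixes g :: "'i \<Rightarrow> 'b::topological_real_vector"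
  assumes "(c \<longlongrightarrow> c0) F" and "(g \<longlongrightarrow> y0) F"
  shows "((\<lambda>i. c i *\<^sub>R g i) \<longlongrightarrow> c0 *\<^sub>R y0) F"
  using filterlim_compose[OF tendsto_scaleR_Pair filterlim_Pair[OF assms]] by simp

text \<open>
  Boundedness is defined by large dilations of \<open>U\<close>; the reciprocal form treats \<open>c = 0\<close> together with
  small positive \<open>c\<close>, which is what limits with coefficients tending to \<open>0\<close> require.
\<close>

lemma small_multiples_of_tvs_bounded:
  assumes "tvs_bounded M" and "open U" and "0 \<in> U"
  obtains r where "r > 0" and "\<And>c y. 0 \<le> c \<Longrightarrow> c \<le> r \<Longrightarrow> y \<in> M \<Longrightarrow> c *\<^sub>R y \<in> U"
proof -
  obtain r where r: "r > 0" "\<And>t. t \<ge> r \<Longrightarrow> M \<subseteq> (\<lambda>u. t *\<^sub>R u) ` U"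
    using assms unfolding tvs_bounded_def by blast
  show ?thesis
  proof (rule that[of "1 / r"])
    fix c y assume c: "0 \<le> c" "c \<le> 1 / r" and y: "y \<in> M"
    show "c *\<^sub>R y \<in> U"
    proof (cases "c = 0")
      case False
      with c r have "r \<le> 1 / c" by (simp add: field_simps)
      then obtain u where "u \<in> U" "y = (1 / c) *\<^sub>R u" using r y by blast
      with False show ?thesis by simp
    qed (simp add: assms)
  qed (use r in simp)
qed

lemma tendsto_zero_scaleR_tvs_bounded:
  assumes M: "tvs_bounded M" and c: "(c \<longlongrightarrow> 0) F" and c0: "\<And>i. 0 \<le> c i" and g: "\<And>i. g i \<in> M"
  shows "((\<lambda>i. c i *\<^sub>R g i) \<longlongrightarrow> 0) F"
proof (rule topological_tendstoI)
  fix U :: "'a set" assume "open U" "0 \<in> U"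
  then obtain r where r: "r > 0" "\<And>c y. 0 \<le> c \<Longrightarrow> c \<le> r \<Longrightarrow> y \<in> M \<Longrightarrow> c *\<^sub>R y \<in> U"
    using small_multiples_of_tvs_bounded[OF M] by metis
  have "\<forall>\<^sub>F i in F. c i < r" using c r(1) by (rule order_tendstoD)
  then show "\<forall>\<^sub>F i in F. c i *\<^sub>R g i \<in> U"
    by eventually_elim (simp add: r c0 g)
qed

lemma open_zero_difference:
  fixes U :: "'b::topological_ab_group_add set"
  assumes "open U" and "0 \<in> U"
  obtains V where "open V" "0 \<in> V" "\<And>a b. a \<in> V \<Longrightarrow> b \<in> V \<Longrightarrow> a - b \<in> U"
proof -
  have "((\<lambda>p::'b \<times> 'b. fst p - snd p) \<longlongrightarrow> 0 - 0) (nhds 0 \<times>\<^sub>F nhds 0)"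
    by (intro tendsto_diff filterlim_fst filterlim_snd)
  then have "\<forall>\<^sub>F p in nhds 0 \<times>\<^sub>F nhds (0::'b). fst p - snd p \<in> U"
    using assms by (simp add: topological_tendstoD)
  then obtain P Q where PQ: "eventually P (nhds (0::'b))" "eventually Q (nhds (0::'b))"
    "\<And>a b. P a \<Longrightarrow> Q b \<Longrightarrow> a - b \<in> U"
    unfolding eventually_prod_filter by auto
  obtain V where "open V" "0 \<in> V" "\<And>a. a \<in> V \<Longrightarrow> P a \<and> Q a"
    using eventually_conj[OF PQ(1,2)] unfolding eventually_nhds by blast
  then show ?thesis using that PQ(3) by blast
qed

section \<open>Infinite convex combinations\<close>

lemma nonneg_combination_in_convex:
  fixes d :: "'i \<Rightarrow> 'b::real_vector"
  assumes "convex D" and "D \<noteq> {}" and "finite I"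
    and "\<And>i. i \<in> I \<Longrightarrow> 0 \<le> w i" and "\<And>i. i \<in> I \<Longrightarrow> d i \<in> D"
  shows "\<exists>a\<in>D. (\<Sum>i\<in>I. w i *\<^sub>R d i) = (\<Sum>i\<in>I. w i) *\<^sub>R a"
proof (cases "(\<Sum>i\<in>I. w i) = 0")
  case True
  then have "\<forall>i\<in>I. w i = 0" using assms by (simp add: sum_nonneg_eq_0_iff)
  then show ?thesis using assms(2) by auto
next
  case False
  define S where "S = (\<Sum>i\<in>I. w i)"
  have S: "S > 0" using False assms(4) by (simp add: S_def sum_nonneg order_less_le)
  have "(\<Sum>i\<in>I. (w i / S) *\<^sub>R d i) \<in> D"
    using assms S by (intro convex_sum) (auto simp: S_def simp flip: sum_divide_distrib)
  moreover have "S *\<^sub>R (\<Sum>i\<in>I. (w i / S) *\<^sub>R d i) = (\<Sum>i\<in>I. w i *\<^sub>R d i)"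
    using S by (simp add: scaleR_sum_right)
  ultimately show ?thesis unfolding S_def by metis
qed

text \<open>
  The partial sums have total weight \<open>W n\<close>, possibly below \<open>1\<close>, and so may lie outside \<open>D\<close>. Giving the
  missing weight \<open>1 - W n\<close> to \<open>d 0\<close> yields points \<open>s n\<close> of \<open>D\<close> with the same limit. For \<open>n \<le> m\<close> the
  difference \<open>s m - s n\<close> is \<open>W m - W n\<close> times a difference of two points of the bounded set \<open>D\<close>, so \<open>s\<close>
  inherits the Cauchy property from \<open>W\<close>.
\<close>

lemma infinite_convex_combination:
  fixes d :: "nat \<Rightarrow> 'b::locally_convex_space"
  assumes D: "convex D" "tvs_bounded D" "semi_complete D"
    and d: "\<And>i. d i \<in> D" and w: "\<And>i. 0 \<le> w i" "w sums 1"
  shows "\<exists>e\<in>D. (\<lambda>n. \<Sum>i<n. w i *\<^sub>R d i) \<longlonglongrightarrow> e"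
proof -
  define W where "W n = (\<Sum>i<n. w i)" for n
  have W_lim: "W \<longlonglongrightarrow> 1" using w(2) by (simp add: sums_def W_def[abs_def])
  have W_bounds: "0 \<le> W n" "W n \<le> 1" for n
    using w sum_le_suminf[of w "{..<n}"] by (auto simp: W_def sum_nonneg sums_iff)
  define s where "s n = (\<Sum>i<n. w i *\<^sub>R d i) + (1 - W n) *\<^sub>R d 0" for n
  have ne: "D \<noteq> {}" using d by auto
  have s_in: "s n \<in> D" for n
  proof -
    obtain a where "a \<in> D" "(\<Sum>i<n. w i *\<^sub>R d i) = W n *\<^sub>R a"
      using nonneg_combination_in_convex[OF D(1) ne, of "{..<n}" w d] w d unfolding W_def by auto
    then show ?thesis
      using D(1) d W_bounds[of n] by (simp add: s_def convexD)
  qed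
  have step: "\<exists>a\<in>D. s m - s n = (W m - W n) *\<^sub>R (a - d 0) \<and> W n \<le> W m" if "n \<le> m" for m n
  proof -
    obtain a where a: "a \<in> D" "(\<Sum>i\<in>{n..<m}. w i *\<^sub>R d i) = (\<Sum>i\<in>{n..<m}. w i) *\<^sub>R a"
      using nonneg_combination_in_convex[OF D(1) ne, of "{n..<m}" w d] w d by auto
    have Wd: "(\<Sum>i\<in>{n..<m}. w i) = W m - W n"
      using that unfolding W_def
      by (metis lessThan_atLeast0 sum_diff_nat_ivl zero_le)
    have "(\<Sum>i\<in>{n..<m}. w i *\<^sub>R d i) = (\<Sum>i<m. w i *\<^sub>R d i) - (\<Sum>i<n. w i *\<^sub>R d i)"
      using that by (metis lessThan_atLeast0 sum_diff_nat_ivl zero_le)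
    with a Wd have "s m - s n = (W m - W n) *\<^sub>R (a - d 0)"
      unfolding s_def by (simp add: algebra_simps)
    moreover have "0 \<le> W m - W n" unfolding Wd[symmetric] using w by (intro sum_nonneg) auto
    ultimately show ?thesis using a by auto
  qed
  have "tvs_Cauchy s"
    unfolding tvs_Cauchy_def
  proof (intro allI impI, elim conjE)
    fix U :: "'b set" assume U: "open U" "0 \<in> U"
    obtain V where V: "open V" "0 \<in> V" "\<And>a b. a \<in> V \<Longrightarrow> b \<in> V \<Longrightarrow> a - b \<in> U"
      using open_zero_difference[OF U] by blast
    obtain r where r: "r > 0" "\<And>c y. 0 \<le> c \<Longrightarrow> c \<le> r \<Longrightarrow> y \<in> D \<Longrightarrow> c *\<^sub>R y \<in> V"
      using small_multiples_of_tvs_bounded[OF D(2) V(1,2)] by metis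
    have "Cauchy W" using W_lim by (rule LIMSEQ_imp_Cauchy)
    then obtain N where N: "\<And>m n. m \<ge> N \<Longrightarrow> n \<ge> N \<Longrightarrow> \<bar>W m - W n\<bar> < r"
      using r(1) unfolding Cauchy_def dist_real_def by blast
    have "s m - s n \<in> U" if mn: "m \<ge> N" "n \<ge> N" for m n
    proof -
      obtain a b where ab: "a \<in> D" "b \<in> D" "s m - s n = \<bar>W m - W n\<bar> *\<^sub>R (a - b)"
      proof (cases "n \<le> m")
        case True
        then show ?thesis using step[OF True] d that by auto
      next
        case False
        then obtain a where a: "a \<in> D" "s n - s m = (W n - W m) *\<^sub>R (a - d 0)" "W m \<le> W n"
          using step[of m n] by auto
        have "s m - s n = - ((W n - W m) *\<^sub>R (a - d 0))" using a(2) by (metis minus_diff_eq)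
        also have "\<dots> = \<bar>W m - W n\<bar> *\<^sub>R (d 0 - a)" using a(3) by (simp add: algebra_simps)
        finally show ?thesis using that a(1) d by blast
      qed
      have "\<bar>W m - W n\<bar> *\<^sub>R a - \<bar>W m - W n\<bar> *\<^sub>R b \<in> U"
        using N[OF mn] ab r V by (intro V(3) r(2)) auto
      then show ?thesis by (simp add: ab(3) scaleR_diff_right)
    qed
    then show "\<exists>N. \<forall>m\<ge>N. \<forall>n\<ge>N. s m - s n \<in> U" by blast
  qed
  then obtain e where e: "e \<in> D" "s \<longlonglongrightarrow> e"
    using D(3) s_in unfolding semi_complete_def by blast
  have "(\<lambda>n. 1 - W n) \<longlonglongrightarrow> 1 - 1" by (intro tendsto_intros W_lim)
  then have "(\<lambda>n. (1 - W n) *\<^sub>R d 0) \<longlonglongrightarrow> 0"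
    using tendsto_scaleR_tvs[OF _ tendsto_const] by fastforce
  then have "(\<lambda>n. s n - (1 - W n) *\<^sub>R d 0) \<longlonglongrightarrow> e - 0"
    by (intro tendsto_diff e)
  then show ?thesis using e(1) by (auto simp: s_def)
qed

section \<open>Decrements along a cone in given directions\<close>

definition decrements :: "'b::real_vector set \<Rightarrow> 'b set \<Rightarrow> real \<Rightarrow> 'b set" where
  "decrements K D t = {t *\<^sub>R d + k |d k. d \<in> D \<and> k \<in> K}"

lemma convex_cone_add: "convex K \<Longrightarrow> cone K \<Longrightarrow> a \<in> K \<Longrightarrow> b \<in> K \<Longrightarrow> a + b \<in> K"
  using convex_cone[of K] by blast

lemma decrementsI: "d \<in> D \<Longrightarrow> y - t *\<^sub>R d \<in> K \<Longrightarrow> y \<in> decrements K D t"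
  unfolding decrements_def by force

lemma decrements_zero: "D \<noteq> {} \<Longrightarrow> decrements K D 0 = K"
  unfolding decrements_def by auto

lemma decrements_add:
  assumes K: "convex K" "cone K" and D: "convex D"
    and "0 \<le> s" "0 \<le> t" and u: "u \<in> decrements K D s" and v: "v \<in> decrements K D t"
  shows "u + v \<in> decrements K D (s + t)"
proof -
  obtain d k where dk: "d \<in> D" "k \<in> K" "u = s *\<^sub>R d + k" using u unfolding decrements_def by blast
  obtain e l where el: "e \<in> D" "l \<in> K" "v = t *\<^sub>R e + l" using v unfolding decrements_def by blast
  have "D \<noteq> {}" using dk by auto
  then obtain a where "a \<in> D" "s *\<^sub>R d + t *\<^sub>R e = (s + t) *\<^sub>R a"
    using nonneg_combination_in_convex[OF D, of UNIV "case_bool s t" "case_bool d e"] assms(4,5) dk el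
    by (fastforce simp: UNIV_bool add.commute split: bool.splits)
  moreover have "k + l \<in> K" using K dk el by (simp add: convex_cone_add)
  ultimately show ?thesis using dk el
    by (intro decrementsI[of a]) (auto simp: algebra_simps)
qed

lemma decrements_antimono:
  assumes K: "convex K" "cone K" and DK: "D \<subseteq> K" and st: "s \<le> t"
  shows "decrements K D t \<subseteq> decrements K D s"
proof
  fix u assume "u \<in> decrements K D t"
  then obtain d k where dk: "d \<in> D" "k \<in> K" "u = t *\<^sub>R d + k" unfolding decrements_def by blast
  have "(t - s) *\<^sub>R d \<in> K" using K(2) DK dk st by (auto simp: cone_def)
  then have "(t - s) *\<^sub>R d + k \<in> K" using K dk by (simp add: convex_cone_add)
  then show "u \<in> decrements K D s" using dk by (intro decrementsI[of d]) (auto simp: algebra_simps)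
qed

text \<open>
  Countably many decreases along varying directions amount to one decrease of the total length:
  normalising the weights turns the series into an infinite convex combination, whose value is the
  common direction. If the total weight vanishes, any direction will do.
\<close>

lemma decrements_series:
  fixes d :: "nat \<Rightarrow> 'b::locally_convex_space"
  assumes K: "closed K" and D: "convex D" "tvs_bounded D" "semi_complete D"
    and d: "\<And>i. d i \<in> D" and w: "\<And>i. 0 \<le> w i" "summable w"
    and y: "\<And>n. y - (\<Sum>i<n. w i *\<^sub>R d i) \<in> K"
  shows "y \<in> decrements K D (suminf w)"
proof (cases "suminf w = 0")
  case True
  have "y \<in> K" using y[of 0] by simp
  then show ?thesis using True d decrements_zero[of D K] by auto
next
  case False
  define S where "S = suminf w"
  have "(\<lambda>i. w i / S) sums (S / S)"
    using w(2) unfolding S_def by (intro sums_divide summable_sums)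
  moreover have "S > 0" using False suminf_nonneg[OF w(2,1)] by (simp add: S_def)
  ultimately obtain e where e: "e \<in> D" "(\<lambda>n. \<Sum>i<n. (w i / S) *\<^sub>R d i) \<longlonglongrightarrow> e"
    using infinite_convex_combination[of D d "\<lambda>i. w i / S"] D d w(1) by auto
  have "(\<lambda>n. S *\<^sub>R (\<Sum>i<n. (w i / S) *\<^sub>R d i)) \<longlonglongrightarrow> S *\<^sub>R e"
    by (intro tendsto_scaleR_tvs tendsto_const e)
  then have "(\<lambda>n. \<Sum>i<n. w i *\<^sub>R d i) \<longlonglongrightarrow> S *\<^sub>R e"
    using \<open>S > 0\<close> by (simp add: scaleR_sum_right)
  then have "(\<lambda>n. y - (\<Sum>i<n. w i *\<^sub>R d i)) \<longlonglongrightarrow> y - S *\<^sub>R e"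
    by (intro tendsto_diff tendsto_const)
  then have "y - S *\<^sub>R e \<in> K"
    by (rule Lim_in_closed_set[rotated -1]) (use K y in auto)
  then show ?thesis using e(1) unfolding S_def by (intro decrementsI)
qed

text \<open>
  If \<open>y - f z\<^sub>n \<in> t\<^sub>n D + K\<close> with \<open>t\<^sub>n \<rightarrow> \<infinity>\<close>, then writing \<open>f z\<^sub>n\<close> as an element of \<open>K\<close> plus some \<open>m\<^sub>n\<close> of a
  bounded set shows \<open>(y - m\<^sub>n) / t\<^sub>n \<in> D + K\<close>, and these points tend to \<open>0\<close>.
\<close>

lemma decrements_bounded:
  fixes f :: "'a \<Rightarrow> 'b::locally_convex_space"
  assumes K: "convex K" "cone K" and zero: "0 \<notin> closure (D + K)" and f: "cone_bounded K f"
  shows "\<exists>B. \<forall>t z. y - f z \<in> decrements K D t \<longrightarrow> t \<le> B"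
proof (rule ccontr)
  assume "\<not> ?thesis"
  then have "\<forall>n. \<exists>t z. y - f z \<in> decrements K D t \<and> t > real (Suc n)" by (meson not_le)
  then obtain t z where tz: "\<And>n. y - f (z n) \<in> decrements K D (t n)" "\<And>n. t n > real (Suc n)"
    by metis
  obtain M where M: "tvs_bounded M" "range f \<subseteq> K + M" using f unfolding cone_bounded_def by blast
  have "\<forall>n. \<exists>m\<in>M. (1 / t n) *\<^sub>R y - (1 / t n) *\<^sub>R m \<in> D + K"
  proof
    fix n
    have t: "t n > 0" using tz(2)[of n] by linarith
    obtain d k where dk: "d \<in> D" "k \<in> K" "y - f (z n) = t n *\<^sub>R d + k"
      using tz(1)[of n] unfolding decrements_def by blast
    obtain l m where lm: "l \<in> K" "m \<in> M" "f (z n) = l + m"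
      using M(2) set_plus_elim[of "f (z n)" K M] by blast
    have "(1 / t n) *\<^sub>R (k + l) \<in> K"
      using K t dk lm convex_cone_add[of K k l] by (simp add: cone_def)
    moreover have "y - m = t n *\<^sub>R d + (k + l)" using dk lm by (simp add: algebra_simps)
    then have "(1 / t n) *\<^sub>R y - (1 / t n) *\<^sub>R m = d + (1 / t n) *\<^sub>R (k + l)"
      using t by (simp add: scaleR_add_right flip: scaleR_diff_right)
    ultimately show "\<exists>m\<in>M. (1 / t n) *\<^sub>R y - (1 / t n) *\<^sub>R m \<in> D + K"
      using lm(2) dk(1) by (intro bexI[of _ m]) (auto intro: set_plus_intro)
  qed
  then obtain m where m: "\<And>n. m n \<in> M" "\<And>n. (1 / t n) *\<^sub>R y - (1 / t n) *\<^sub>R m n \<in> D + K"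
    by metis
  have t0: "0 \<le> 1 / t n" "1 / t n \<le> 1 / real (Suc n)" for n
    using tz(2)[of n] by (auto intro!: divide_left_mono mult_pos_pos)
  have t_lim: "(\<lambda>n. 1 / t n) \<longlonglongrightarrow> 0"
    by (rule tendsto_sandwich[OF _ _ tendsto_const lim_1_over_n[THEN LIMSEQ_Suc]])
      (intro always_eventually allI t0)+
  have "(\<lambda>n. (1 / t n) *\<^sub>R y - (1 / t n) *\<^sub>R m n) \<longlonglongrightarrow> 0 *\<^sub>R y - 0"
    using t0 m M t_lim
    by (intro tendsto_diff tendsto_scaleR_tvs tendsto_const tendsto_zero_scaleR_tvs_bounded[OF M(1)])
  then have "0 *\<^sub>R y - 0 \<in> closure (D + K)"
    by (rule Lim_in_closed_set[rotated -1])
      (use m(2) in \<open>auto intro!: always_eventually closure_subset[THEN subsetD]\<close>)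
  with zero show False by simp
qed

section \<open>Minimal points of a preorder with a potential\<close>

text \<open>
  Ekeland's argument freed from the particular order. From each point the sequence moves to a lower
  point whose potential is within \<open>1 / (n + 1)\<close> of the infimum over everything below. Points lying below
  all members of the sequence are then ever closer to those members, so they coincide with the
  limit. The hypothesis \<open>lim\<close> compares the limit with the first member only; applied to the tails of
  a sequence it covers all members.
\<close>

lemma exists_minimal_below:
  fixes R :: "'a::complete_space \<Rightarrow> 'a \<Rightarrow> bool" and Q :: "'a \<Rightarrow> real"
  assumes refl: "\<And>y. R y y" and trans: "\<And>u v w. R u v \<Longrightarrow> R v w \<Longrightarrow> R u w"
    and Q0: "\<And>y. 0 \<le> Q y" and c: "c > 0"
    and drop: "\<And>z y. R z y \<Longrightarrow> c * dist z y \<le> Q y - Q z"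
    and lim: "\<And>s l. (\<And>n. R (s (Suc n)) (s n)) \<Longrightarrow> s \<longlonglongrightarrow> l \<Longrightarrow> R l (s 0)"
  shows "\<exists>y. R y x \<and> (\<forall>z. R z y \<longrightarrow> z = y)"
proof -
  have near_inf: "\<exists>y'. R y' y \<and> (\<forall>z. R z y \<longrightarrow> Q y' < Q z + 1 / Suc n)" for y n
  proof -
    have bdd: "bdd_below (Q ` {z. R z y})" using Q0 by (intro bdd_belowI2[of _ 0])
    have "Inf (Q ` {z. R z y}) < Inf (Q ` {z. R z y}) + 1 / Suc n" by simp
    then obtain y' where y': "R y' y" "Q y' < Inf (Q ` {z. R z y}) + 1 / Suc n"
      using refl by (subst (asm) cInf_less_iff[OF _ bdd]) auto
    have "Inf (Q ` {z. R z y}) \<le> Q z" if "R z y" for z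
      using that bdd by (auto intro: cInf_lower)
    with y' show ?thesis by (intro exI[of _ y']) fastforce
  qed
  define next_pt where
    "next_pt n y = (SOME y'. R y' y \<and> (\<forall>z. R z y \<longrightarrow> Q y' < Q z + 1 / Suc n))" for n y
  have np: "R (next_pt n y) y" "R z y \<Longrightarrow> Q (next_pt n y) < Q z + 1 / Suc n" for n y z
    using someI_ex[OF near_inf[of y n]] unfolding next_pt_def by auto
  define s where "s = rec_nat x next_pt"
  have s: "s 0 = x" "\<And>n. s (Suc n) = next_pt n (s n)" by (simp_all add: s_def)
  have step: "R (s (Suc n)) (s n)" for n using np(1) by (simp add: s)
  have below: "R (s (n + k)) (s n)" for n k
  proof (induction k)
    case (Suc k)
    then show ?case using trans[OF step[of "n + k"]] by simp
  qed (simp add: refl)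
  have small: "dist z (s (Suc n)) \<le> 1 / c * (1 / Suc n)" if "R z (s (Suc n))" for z n
  proof -
    have "R z (s n)" using that step trans by blast
    then have "Q (s (Suc n)) < Q z + 1 / Suc n" using np(2) by (simp add: s)
    with drop[OF that] have "c * dist z (s (Suc n)) \<le> 1 / Suc n" by linarith
    then have "dist z (s (Suc n)) \<le> (1 / Suc n) / c"
      by (subst pos_le_divide_eq[OF c]) (simp only: mult.commute)
    then show ?thesis by (simp add: mult.commute)
  qed
  have small_lim: "(\<lambda>n. 1 / c * (1 / Suc n)) \<longlonglongrightarrow> 0"
    using tendsto_mult[OF tendsto_const lim_1_over_n[THEN LIMSEQ_Suc], of "1 / c"] by simp
  \<comment> \<open>This gives uniqueness: a point below the limit is below every \<open>s n\<close>, so it is a limit too.\<close>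
  have conv: "s \<longlonglongrightarrow> z" if "\<And>n. R z (s n)" for z
  proof -
    have "norm (dist (s (Suc n)) z) \<le> 1 / c * (1 / Suc n)" for n
      using small[OF that, of n] by (simp only: real_norm_def abs_of_nonneg[OF zero_le_dist] dist_commute)
    then have "(\<lambda>n. dist (s (Suc n)) z) \<longlonglongrightarrow> 0"
      by (intro Lim_null_comparison[OF _ small_lim] always_eventually allI)
    then have "(\<lambda>n. s (Suc n)) \<longlonglongrightarrow> z" by (rule iffD2[OF tendsto_dist_iff])
    then show ?thesis by (rule LIMSEQ_imp_Suc)
  qed
  have "Cauchy s"
    unfolding Cauchy_altdef2
  proof (intro allI impI)
    fix e :: real assume "e > 0"
    then have "\<forall>\<^sub>F n in sequentially. 1 / c * (1 / Suc n) < e"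
      by (rule order_tendstoD(2)[OF small_lim])
    then obtain N where N: "1 / c * (1 / Suc N) < e"
      unfolding eventually_sequentially by blast
    have "dist (s n) (s (Suc N)) < e" if "n \<ge> Suc N" for n
      using small[of "s n" N] below[of "Suc N" "n - Suc N"] that N by simp
    then show "\<exists>N. \<forall>n\<ge>N. dist (s n) (s N) < e" by blast
  qed
  then obtain l where l: "s \<longlonglongrightarrow> l" by (auto simp: Cauchy_convergent_iff convergent_def)
  have l_below: "R l (s n)" for n
    using lim[of "\<lambda>k. s (n + k)" l] step l by (simp add: LIMSEQ_ignore_initial_segment add.commute)
  have "z = l" if "R z l" for z
  proof (rule LIMSEQ_unique[OF conv l])
    show "R z (s n)" for n using trans[OF that l_below] .
  qed
  with l_below[of 0] s(1) show ?thesis by auto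
qed

section \<open>The vector variational principle\<close>

text \<open>
  Telescoping shows that \<open>f (s 0) - f (s n)\<close>, and hence \<open>f (s 0) - f l\<close>, is the \<open>n\<close>-th partial sum of the
  step decreases plus an element of \<open>K\<close>; \<open>decrements_series\<close> merges these into a single decrease whose length is \<open>\<epsilon>\<close> times the
  length of the path \<open>s\<close>. That path is at least as long as the distance from \<open>s 0\<close> to \<open>l\<close>, so the decrease
  may be shortened to \<open>\<epsilon> * dist l (s 0)\<close>.
\<close>

lemma limit_of_decreasing_sequence:
  fixes f :: "'a::complete_space \<Rightarrow> 'b::locally_convex_space"
  assumes K: "closed K" "convex K" "cone K"
    and D: "D \<subseteq> K" "semi_complete D" "convex D" "tvs_bounded D"
    and f: "mono_semicontinuous K f" and \<epsilon>: "\<epsilon> > 0"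
    and step: "\<And>n. f (s n) - f (s (Suc n)) \<in> decrements K D (\<epsilon> * dist (s (Suc n)) (s n))"
    and sum: "summable (\<lambda>n. dist (s (Suc n)) (s n))" and l: "s \<longlonglongrightarrow> l"
  shows "f (s 0) - f l \<in> decrements K D (\<epsilon> * dist l (s 0))"
proof -
  define w where "w n = \<epsilon> * dist (s (Suc n)) (s n)" for n
  have w: "\<And>n. 0 \<le> w n" "summable w" using \<epsilon> sum by (auto simp: w_def[abs_def])
  obtain d where d: "\<And>n. d n \<in> D" "\<And>n. f (s n) - f (s (Suc n)) - w n *\<^sub>R d n \<in> K"
  proof -
    have "\<forall>n. \<exists>d\<in>D. f (s n) - f (s (Suc n)) - w n *\<^sub>R d \<in> K"
    proof
      fix n
      obtain a k where "a \<in> D" "k \<in> K" "f (s n) - f (s (Suc n)) = w n *\<^sub>R a + k"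
        using step[of n] unfolding decrements_def w_def by blast
      then show "\<exists>a\<in>D. f (s n) - f (s (Suc n)) - w n *\<^sub>R a \<in> K"
        by (intro bexI[of _ a]) simp_all
    qed
    then show ?thesis using that by metis
  qed
  have K_add: "a + b \<in> K" if "a \<in> K" "b \<in> K" for a b
    using K that by (simp add: convex_cone_add)
  have "0 \<in> K" using D(1) K(3) d(1)[of 0] by (metis cone_def order_refl scaleR_zero_left subsetD)
  have partial: "f (s 0) - f (s n) - (\<Sum>i<n. w i *\<^sub>R d i) \<in> K" for n
  proof (induction n)
    case (Suc n)
    show ?case using K_add[OF Suc d(2)[of n]] by (simp add: algebra_simps)
  qed (simp add: \<open>0 \<in> K\<close>)
  have f_step: "cone_le K (f (s (Suc n))) (f (s n))" for n
  proof -
    have "w n *\<^sub>R d n \<in> K" using w(1)[of n] d(1)[of n] D(1) K(3) unfolding cone_def by blast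
    from K_add[OF d(2)[of n] this] show ?thesis by (simp add: cone_le_def)
  qed
  have f_l: "f (s n) - f l \<in> K" for n
    using f l f_step unfolding mono_semicontinuous_def mono_semicontinuous_at_def cone_le_def by blast
  have "f (s 0) - f l - (\<Sum>i<n. w i *\<^sub>R d i) \<in> K" for n
    using K_add[OF partial[of n] f_l[of n]] by (simp add: algebra_simps)
  then have "f (s 0) - f l \<in> decrements K D (suminf w)"
    by (intro decrements_series[of K D d w] K D d w)
  moreover have "\<epsilon> * dist l (s 0) \<le> suminf w"
  proof (rule LIMSEQ_le_const2)
    show "(\<lambda>n. \<epsilon> * dist (s n) (s 0)) \<longlonglongrightarrow> \<epsilon> * dist l (s 0)"
      by (intro tendsto_intros l)
    have "\<epsilon> * dist (s n) (s 0) \<le> (\<Sum>i<n. w i)" for n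
    proof (induction n)
      case (Suc n)
      have "\<epsilon> * dist (s (Suc n)) (s 0) \<le> \<epsilon> * (dist (s (Suc n)) (s n) + dist (s n) (s 0))"
        using \<epsilon> by (intro mult_left_mono dist_triangle) auto
      with Suc show ?case by (simp add: w_def algebra_simps)
    qed simp
    then show "\<exists>N. \<forall>n\<ge>N. \<epsilon> * dist (s n) (s 0) \<le> suminf w"
      using sum_le_suminf[OF w(2)] w(1) by (meson finite_lessThan order_trans)
  qed
  ultimately show ?thesis using decrements_antimono[OF K(2,3) D(1)] by blast
qed

lemma exists_minimal_for_decrements:
  fixes f :: "'a::complete_space \<Rightarrow> 'b::locally_convex_space"
  assumes K: "closed K" "convex K" "cone K"
    and D: "D \<subseteq> K" "D \<noteq> {}" "semi_complete D" "convex D" "tvs_bounded D"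
    and zero: "0 \<notin> closure (D + K)"
    and f: "mono_semicontinuous K f" "cone_bounded K f" and \<epsilon>: "\<epsilon> > 0"
  shows "\<exists>y. f x - f y \<in> decrements K D (\<epsilon> * dist y x) \<and>
    (\<forall>z. f y - f z \<in> decrements K D (\<epsilon> * dist z y) \<longrightarrow> z = y)"
proof -
  define T where "T y = {t. 0 \<le> t \<and> (\<exists>z. f y - f z \<in> decrements K D t)}" for y
  have "0 \<in> K" using D(1,2) K(3) by (metis cone_def order_refl scaleR_zero_left subsetD ex_in_conv)
  then have zero_T: "0 \<in> T y" for y
    using decrements_zero[OF D(2), of K] unfolding T_def by (auto intro: exI[of _ y])
  have bdd: "bdd_above (T y)" for y
    using decrements_bounded[OF K(2,3) zero f(2), of "f y"] unfolding T_def bdd_above_def by blast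
  let ?R = "\<lambda>z y. f y - f z \<in> decrements K D (\<epsilon> * dist z y)"
  \<comment> \<open>Any decrease \<open>t\<close> available from \<open>z\<close> can be preceded by the one from \<open>y\<close> to \<open>z\<close>, so \<open>\<epsilon> * dist z y + t\<close> is
    available from \<open>y\<close>.\<close>
  have drop: "\<epsilon> * dist z y \<le> Sup (T y) - Sup (T z)" if R: "?R z y" for z y
  proof -
    have "t \<le> Sup (T y) - \<epsilon> * dist z y" if t: "t \<in> T z" for t
    proof -
      obtain z' where "f z - f z' \<in> decrements K D t" "0 \<le> t" using t unfolding T_def by blast
      from decrements_add[OF K(2,3) D(4) _ this(2) R this(1)] \<epsilon> this(2)
      have "\<epsilon> * dist z y + t \<in> T y" unfolding T_def by (auto simp: algebra_simps)
      then show ?thesis using cSup_upper[OF _ bdd] by fastforce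
    qed
    then have "Sup (T z) \<le> Sup (T y) - \<epsilon> * dist z y"
      using zero_T by (intro cSup_least) auto
    then show ?thesis by simp
  qed
  have nonneg: "0 \<le> Sup (T y)" for y using zero_T bdd by (rule cSup_upper)
  show ?thesis
  proof (rule exists_minimal_below[where R = ?R and Q = "\<lambda>y. Sup (T y)" and c = \<epsilon>, OF _ _ nonneg \<epsilon> drop])
    show "?R y y" for y using \<open>0 \<in> K\<close> decrements_zero[OF D(2), of K] by simp
    show "?R u w" if uv: "?R u v" and vw: "?R v w" for u v w
    proof -
      have "f w - f v + (f v - f u) \<in> decrements K D (\<epsilon> * dist v w + \<epsilon> * dist u v)"
        using \<epsilon> by (intro decrements_add K D uv vw) auto
      moreover have "\<epsilon> * dist u w \<le> \<epsilon> * dist v w + \<epsilon> * dist u v"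
        using \<epsilon> dist_triangle[of u w v] by (simp flip: distrib_left)
      ultimately show ?thesis using decrements_antimono[OF K(2,3) D(1)] by fastforce
    qed
    show "?R l (s 0)" if step: "\<And>n. ?R (s (Suc n)) (s n)" and l: "s \<longlonglongrightarrow> l" for s l
    proof -
      \<comment> \<open>The potential pays for every step, so the path \<open>s\<close> has finite length.\<close>
      have "(\<Sum>i<n. \<epsilon> * dist (s (Suc i)) (s i)) \<le> Sup (T (s 0)) - Sup (T (s n))" for n
      proof (induction n)
        case (Suc n)
        then show ?case using drop[OF step[of n]] by simp
      qed simp
      then have "(\<Sum>i<n. \<epsilon> * dist (s (Suc i)) (s i)) \<le> Sup (T (s 0))" for n
        by (rule order_trans) (simp add: nonneg)
      then have "summable (\<lambda>i. \<epsilon> * dist (s (Suc i)) (s i))"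
        using \<epsilon> by (intro bounded_imp_summable[where B = "Sup (T (s 0))"])
          (simp_all del: sum.lessThan_Suc flip: lessThan_Suc_atMost)
      then have "summable (\<lambda>i. dist (s (Suc i)) (s i))" using \<epsilon> by (simp add: summable_cmult_iff)
      from limit_of_decreasing_sequence[OF K D(1,3-5) f(1) \<epsilon> step this l] show ?thesis .
    qed
  qed
qed

theorem theorem5p1:
  fixes f :: "'a::complete_space \<Rightarrow> 'b::locally_convex_space"
    and K D :: "'b set"
  assumes "closed K" and "convex K" and "cone K"
    and "D \<subseteq> K" and "D \<noteq> {}" and "closed D" and "semi_complete D" and "convex D"
    and "tvs_bounded D"
    and "0 \<notin> closure (D + K)"
    and "mono_semicontinuous K f" and "cone_bounded K f"
  shows "\<forall>x. \<forall>\<epsilon>>0. \<forall>\<delta>>0. \<exists>xbar.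
      {f x - k |k. k \<in> K} \<inter> {f xbar + (\<epsilon> * dist x xbar) *\<^sub>R d |d. d \<in> D} \<noteq> {} \<and>
      (\<forall>z. z \<noteq> xbar \<longrightarrow>
        {f xbar - k |k. k \<in> K} \<inter> {f z + (\<epsilon> * dist z xbar) *\<^sub>R d |d. d \<in> D} = {}) \<and>
      (approx_solution K D f (\<epsilon> * \<delta>) x \<longrightarrow> dist x xbar < \<delta>)"
proof (intro allI impI)
  fix x :: 'a and \<epsilon> \<delta> :: real assume \<epsilon>: "\<epsilon> > 0" and \<delta>: "\<delta> > 0"
  have meet: "{f a - k |k. k \<in> K} \<inter> {f b + t *\<^sub>R d |d. d \<in> D} \<noteq> {} \<longleftrightarrow> f a - f b \<in> decrements K D t"
    for a b t
  proof
    assume "{f a - k |k. k \<in> K} \<inter> {f b + t *\<^sub>R d |d. d \<in> D} \<noteq> {}"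
    then obtain k d where "k \<in> K" "d \<in> D" "f a - k = f b + t *\<^sub>R d" by blast
    moreover from this(3) have "f a - f b - t *\<^sub>R d = k" by (simp add: algebra_simps)
    ultimately show "f a - f b \<in> decrements K D t" by (intro decrementsI[of d]) auto
  next
    assume "f a - f b \<in> decrements K D t"
    then obtain d k where dk: "d \<in> D" "k \<in> K" "f a - f b = t *\<^sub>R d + k"
      unfolding decrements_def by blast
    then have "f a - k = f b + t *\<^sub>R d" by (simp add: algebra_simps)
    with dk show "{f a - k |k. k \<in> K} \<inter> {f b + t *\<^sub>R d |d. d \<in> D} \<noteq> {}" by blast
  qed
  obtain y where y: "f x - f y \<in> decrements K D (\<epsilon> * dist y x)"
    "\<And>z. f y - f z \<in> decrements K D (\<epsilon> * dist z y) \<Longrightarrow> z = y"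
    using exists_minimal_for_decrements[of K D f \<epsilon> x] assms \<epsilon> by blast
  have "dist x y < \<delta>" if approx: "approx_solution K D f (\<epsilon> * \<delta>) x"
  proof (rule ccontr)
    assume "\<not> dist x y < \<delta>"
    then have "\<epsilon> * \<delta> \<le> \<epsilon> * dist y x" using \<epsilon> by (simp add: dist_commute)
    then have "f x - f y \<in> decrements K D (\<epsilon> * \<delta>)"
      using decrements_antimono[of K D] assms(2-4) y(1) by blast
    then obtain d k where dk: "d \<in> D" "k \<in> K" "f x - f y = (\<epsilon> * \<delta>) *\<^sub>R d + k"
      unfolding decrements_def by blast
    then have "f y = f x - (\<epsilon> * \<delta>) *\<^sub>R d - k" by (simp add: algebra_simps)
    with dk approx show False unfolding approx_solution_def by blast
  qed
  moreover have "{f x - k |k. k \<in> K} \<inter> {f y + (\<epsilon> * dist x y) *\<^sub>R d |d. d \<in> D} \<noteq> {}"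
    unfolding meet using y(1) by (simp add: dist_commute)
  moreover have "{f y - k |k. k \<in> K} \<inter> {f z + (\<epsilon> * dist z y) *\<^sub>R d |d. d \<in> D} = {}" if "z \<noteq> y" for z
    using meet[of y z "\<epsilon> * dist z y"] y(2)[of z] that by blast
  ultimately show "\<exists>xbar.
      {f x - k |k. k \<in> K} \<inter> {f xbar + (\<epsilon> * dist x xbar) *\<^sub>R d |d. d \<in> D} \<noteq> {} \<and>
      (\<forall>z. z \<noteq> xbar \<longrightarrow>
        {f xbar - k |k. k \<in> K} \<inter> {f z + (\<epsilon> * dist z xbar) *\<^sub>R d |d. d \<in> D} = {}) \<and>
      (approx_solution K D f (\<epsilon> * \<delta>) x \<longrightarrow> dist x xbar < \<delta>)"
    by blast
qed

end
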